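(* Let $q=a+v\in\mathbb{H}_\mathbb{R}$ with $a>1$ and $v\ne0$, let $w:=a+i|v|\in\mathbb{C}$, and let $z\in\mathbb{C}$ with $|z|=1$. Then the complex quaternion $\sum_{\ell\in\mathbb{Z}}B_q(\ell)z^\ell$ is invertible in $\mathbb{H}_\mathbb{C}$ if and only if $$\Big(\sum_{\ell\in\mathbb{Z}}B_w(\ell)z^\ell\Big)\Big(\sum_{k\in\mathbb{Z}}B_{\overline w}(k)z^k\Big)\neq0,$$ and in that case $$\Big(\sum_{\ell}B_q(\ell)z^\ell\Big)^{-1}=\frac{\sum_\ell\big[\mathrm{Re}\,B_w(\ell)-\frac{v}{|v|}\mathrm{Im}\,B_w(\ell)\big]z^\ell}{\Big(\sum_\ell B_w(\ell)z^\ell\Big)\Big(\sum_\ell B_{\overline w}(\ell)z^\ell\Big)}.$$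
   Context: $\mathbb{H}_\mathbb{R}$ denotes the real quaternions $a+v_1e_1+v_2e_2+v_3e_3$ with $e_1^2=e_2^2=e_3^2=-1$, $e_1e_2=e_3$, $e_2e_3=e_1$, $e_3e_1=e_2$; $\mathbb{H}_\mathbb{C}$ the complex quaternions (complex coefficients, $i$ commuting with every $e_j$). For $q=a+v$, $v=\sum v_je_j$ and $|v|=(\sum v_j^2)^{1/2}$. Quaternionic power: for $\zeta\in\mathbb{C}\setminus\{0\}$, $\zeta^q:=\zeta^a[\cos(|v|\log\zeta)+\frac{v}{|v|}\sin(|v|\log\zeta)]$ (principal $\log$). Let $\Xi(\xi):=\frac{1-e^{-i\xi}}{i\xi}$, $\Xi(0):=1$. Quaternionic B-spline: $B_q(t):=\frac1{2\pi}\int_\mathbb{R}\Xi(\xi)^qe^{i\xi t}d\xi$ ($\mathrm{Sc}\,q>1$); complex B-spline: for $w\in\mathbb{C}$ with $\mathrm{Re}\,w>1$, $B_w(t):=\frac1{2\pi}\int_\mathbb{R}e^{w\log\Xi(\xi)}e^{i\xi t}d\xi$ (principal $\log$). The series $\sum_\ell B_q(\ell)z^\ell$, $\sum_\ell B_w(\ell)z^\ell$ converge absolutely. *)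

theory Defs
  imports "HOL-Analysis.Analysis"
begin

datatype cquat = CQuat (cq_sc: complex) (cq_1: complex) (cq_2: complex) (cq_3: complex)

definition cq_one :: cquat where "cq_one = CQuat 1 0 0 0"

text \<open>Hamilton product with e1 e2 = e3, e2 e3 = e1, e3 e1 = e2, ej^2 = -1.\<close>
definition cq_mult :: "cquat \<Rightarrow> cquat \<Rightarrow> cquat" where
  "cq_mult x y = CQuat
     (cq_sc x * cq_sc y - cq_1 x * cq_1 y - cq_2 x * cq_2 y - cq_3 x * cq_3 y)
     (cq_sc x * cq_1 y + cq_1 x * cq_sc y + cq_2 x * cq_3 y - cq_3 x * cq_2 y)
     (cq_sc x * cq_2 y + cq_2 x * cq_sc y + cq_3 x * cq_1 y - cq_1 x * cq_3 y)
     (cq_sc x * cq_3 y + cq_3 x * cq_sc y + cq_1 x * cq_2 y - cq_2 x * cq_1 y)"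

definition cq_invertible :: "cquat \<Rightarrow> bool" where
  "cq_invertible x \<longleftrightarrow> (\<exists>y. cq_mult x y = cq_one \<and> cq_mult y x = cq_one)"

definition cq_inverse :: "cquat \<Rightarrow> cquat" where
  "cq_inverse x = (THE y. cq_mult x y = cq_one \<and> cq_mult y x = cq_one)"

definition cq_scale :: "complex \<Rightarrow> cquat \<Rightarrow> cquat" where
  "cq_scale c x = CQuat (c * cq_sc x) (c * cq_1 x) (c * cq_2 x) (c * cq_3 x)"

text \<open>Quaternionic power zeta^q for a real quaternion q = a + v, v = (v1,v2,v3),
  using the principal logarithm. For zeta = 0 (a null set in the integrals) we put 0.\<close>
definition qpow :: "complex \<Rightarrow> real \<Rightarrow> real^3 \<Rightarrow> cquat" where
  "qpow \<zeta> a v =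
     (if \<zeta> = 0 then CQuat 0 0 0 0
      else if v = 0 then CQuat (\<zeta> powr complex_of_real a) 0 0 0
      else CQuat (\<zeta> powr complex_of_real a * cos (complex_of_real (norm v) * Ln \<zeta>))
                 (\<zeta> powr complex_of_real a * complex_of_real (v $ 1 / norm v) * sin (complex_of_real (norm v) * Ln \<zeta>))
                 (\<zeta> powr complex_of_real a * complex_of_real (v $ 2 / norm v) * sin (complex_of_real (norm v) * Ln \<zeta>))
                 (\<zeta> powr complex_of_real a * complex_of_real (v $ 3 / norm v) * sin (complex_of_real (norm v) * Ln \<zeta>)))"

definition Xi :: "real \<Rightarrow> complex" where
  "Xi \<xi> = (if \<xi> = 0 then 1 else (1 - exp (- (\<i> * complex_of_real \<xi>))) / (\<i> * complex_of_real \<xi>))"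

definition qBspline :: "real \<Rightarrow> real^3 \<Rightarrow> real \<Rightarrow> cquat" where
  "qBspline a v t =
     (let F = (\<lambda>c. complex_of_real (1 / (2 * pi)) *
                  (LINT \<xi>|lborel. c (qpow (Xi \<xi>) a v) * exp (\<i> * complex_of_real \<xi> * complex_of_real t)))
      in CQuat (F cq_sc) (F cq_1) (F cq_2) (F cq_3))"

definition cBspline :: "complex \<Rightarrow> real \<Rightarrow> complex" where
  "cBspline w t = complex_of_real (1 / (2 * pi)) *
     (LINT \<xi>|lborel. exp (w * Ln (Xi \<xi>)) * exp (\<i> * complex_of_real \<xi> * complex_of_real t))"

definition cq_zseries :: "(int \<Rightarrow> cquat) \<Rightarrow> complex \<Rightarrow> cquat" where
  "cq_zseries f z = CQuat (\<Sum>\<^sub>\<infinity>l. cq_sc (f l) * z powi l) (\<Sum>\<^sub>\<infinity>l. cq_1 (f l) * z powi l)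
                          (\<Sum>\<^sub>\<infinity>l. cq_2 (f l) * z powi l) (\<Sum>\<^sub>\<infinity>l. cq_3 (f l) * z powi l)"

end

theory Submission
  imports Defs "HOL-Probability.Characteristic_Functions"
begin

text \<open>Put $n = v/|v|$, so that $n^2 = -1$. Since \<open>Xi\<close> never takes values in the negative real axis,
  \<open>Xi (-\<xi>) = cnj (Xi \<xi>)\<close> carries over to the principal powers, whence
  $B_{\overline w} = \overline{B_w}$ and $B_q = \mathrm{Re}\,B_w + n\,\mathrm{Im}\,B_w$ on the real line. Once the
  series converge absolutely, $\sum B_q(\ell) z^\ell = R + n I$ with $\sum B_w(\ell)z^\ell = R + i I$ and
  $\sum B_{\overline w}(\ell)z^\ell = R - i I$, and everything follows from $(R + nI)(R - nI) = R^2 + I^2$.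

  Absolute convergence is obtained by duality: for unimodular $u_\ell$ and finite $F \not\ni 0$ the sum
  $\sum_{\ell\in F} u_\ell B_w(\ell)$ is, up to a constant, the integral of \<open>Xi\<close>$^w$ against $H'$ for a
  trigonometric polynomial $H$ with coefficients $u_\ell/(i\ell)$. Integrating by parts between zeros of
  \<open>Xi\<close>, where the derivative of \<open>Xi\<close>$^w$ is $O(k^{-\mathrm{Re}\,w})$ on the $k$-th period, and using
  $|H| \le (1+|H|^2)/2$ with the orthogonality of exponentials on each period, gives a bound
  independent of $F$ and $u$.\<close>

subsection \<open>The function \<open>Xi\<close> and its principal powers\<close>

text \<open>Clearing the denominator gives an identity that also covers \<xi> = 0, where both sides
  are 0, so later arguments avoid the case split in \<open>Xi_def\<close>.\<close>

lemma Xi_mult: "\<i> * complex_of_real \<xi> * Xi \<xi> = 1 - exp (- (\<i> * complex_of_real \<xi>))"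
  by (simp add: Xi_def)

lemma norm_Xi_le_1: "norm (Xi \<xi>) \<le> 1"
proof (cases "\<xi> = 0")
  case False
  have "\<bar>\<xi>\<bar> * norm (Xi \<xi>) = norm (\<i> * complex_of_real \<xi> * Xi \<xi>)"
    by (simp add: norm_mult)
  also have "\<dots> \<le> \<bar>\<xi>\<bar> * 1"
    unfolding Xi_mult using iexp_approx1[of "-\<xi>" 0] by (simp add: norm_minus_commute)
  finally show ?thesis
    using False by simp
qed (simp add: Xi_def)

lemma abs_mult_norm_Xi_le: "\<bar>\<xi>\<bar> * norm (Xi \<xi>) \<le> 2"
proof -
  have "\<bar>\<xi>\<bar> * norm (Xi \<xi>) = norm (\<i> * complex_of_real \<xi> * Xi \<xi>)"
    by (simp add: norm_mult)
  also have "\<dots> \<le> 2"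
    unfolding Xi_mult by (rule norm_triangle_le_diff) simp
  finally show ?thesis .
qed

text \<open>The next Taylor order controls the removable singularity: it yields continuity of
  \<open>Xi\<close> at 0 and a bound on its derivative near 0.\<close>

lemma norm_Xi_minus_1_le: "norm (Xi \<xi> - 1) \<le> \<bar>\<xi>\<bar> / 2"
proof (cases "\<xi> = 0")
  case False
  have "\<i> * complex_of_real \<xi> * (Xi \<xi> - 1) = - (iexp (-\<xi>) - (1 + \<i> * complex_of_real (-\<xi>)))"
    by (simp add: right_diff_distrib Xi_mult)
  hence "\<bar>\<xi>\<bar> * norm (Xi \<xi> - 1) = norm (iexp (-\<xi>) - (1 + \<i> * complex_of_real (-\<xi>)))"
    by (metis norm_minus_cancel norm_mult norm_ii norm_of_real mult_1)
  also have "\<dots> \<le> \<bar>\<xi>\<bar> * (\<bar>\<xi>\<bar> / 2)"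
    using iexp_approx1[of "-\<xi>" 1] by (simp add: power2_eq_square)
  finally show ?thesis
    using False by (subst (asm) mult_le_cancel_left_pos) simp_all
qed (simp add: Xi_def)

lemma Xi_minus: "Xi (-\<xi>) = cnj (Xi \<xi>)"
  by (simp add: Xi_def exp_cnj)

lemma Xi_eq_0_imp:
  assumes "Xi \<xi> = 0"
  obtains k :: int where "\<xi> = 2 * pi * of_int k"
proof -
  have "exp (- (\<i> * complex_of_real \<xi>)) = 1"
    using Xi_mult[of \<xi>] assms by simp
  then obtain n :: int where "- \<xi> = of_int (2 * n) * pi"
    by (auto simp: exp_eq_1)
  hence "\<xi> = 2 * pi * of_int (-n)"
    by (simp add: algebra_simps)
  thus ?thesis using that by blast
qed

lemma Xi_2pi:
  assumes "k \<noteq> 0"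
  shows "Xi (2 * pi * of_int k) = 0"
proof -
  have "exp (- (\<i> * complex_of_real (2 * pi * of_int k))) = 1"
    unfolding exp_eq_1 by (auto intro!: exI[of _ "-k"])
  thus ?thesis using assms by (simp add: Xi_def)
qed

lemma countable_Xi_zeros: "countable {\<xi>. Xi \<xi> = 0}"
proof (rule countable_subset)
  show "{\<xi>. Xi \<xi> = 0} \<subseteq> range (\<lambda>k::int. 2 * pi * of_int k)"
    by (auto elim!: Xi_eq_0_imp)
qed auto

text \<open>If \<open>Xi \<xi>\<close> is real, the left side of \<open>Xi_mult\<close> is purely
  imaginary; comparing real parts gives cos \<xi> = 1, so the numerator vanishes. Hence
  \<open>Xi\<close> meets the branch cut of \<open>Ln\<close> only at its zeros, and elsewhere
  principal powers are smooth and compatible with conjugation.\<close>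

lemma Xi_nonpos_Reals_imp_0:
  assumes "Xi \<xi> \<in> \<real>\<^sub>\<le>\<^sub>0"
  shows "Xi \<xi> = 0"
proof -
  have "\<xi> \<noteq> 0" using assms by (auto simp: Xi_def)
  have "\<i> * complex_of_real \<xi> * Xi \<xi> = 1 - exp (- (\<i> * complex_of_real \<xi>))"
    by (rule Xi_mult)
  moreover have "Im (Xi \<xi>) = 0"
    using assms by (simp add: complex_nonpos_Reals_iff)
  ultimately have "cos \<xi> = 1"
    by (simp add: complex_eq_iff Re_exp)
  hence "exp (- (\<i> * complex_of_real \<xi>)) = 1"
    using sin_cos_squared_add[of \<xi>] by (simp add: complex_eq_iff Re_exp Im_exp)
  thus ?thesis
    by (simp add: Xi_def \<open>\<xi> \<noteq> 0\<close>)
qed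

lemma continuous_Xi: "continuous_on UNIV Xi"
proof -
  have "isCont Xi \<xi>" for \<xi>
  proof (cases "\<xi> = 0")
    case True
    have "((\<lambda>x. Xi x - 1) \<longlongrightarrow> 0) (at 0)"
    proof (rule Lim_null_comparison)
      show "\<forall>\<^sub>F x in at 0. norm (Xi x - 1) \<le> \<bar>x\<bar> / 2"
        by (intro always_eventually allI norm_Xi_minus_1_le)
      show "((\<lambda>x::real. \<bar>x\<bar> / 2) \<longlongrightarrow> 0) (at 0)"
        by (auto intro!: tendsto_eq_intros)
    qed
    moreover have "Xi 0 = 1" by (simp add: Xi_def)
    ultimately show ?thesis
      unfolding True isCont_def by (simp add: LIM_zero_iff)
  next
    case False
    have "continuous_on (- {0}) (\<lambda>x. (1 - exp (- (\<i> * complex_of_real x))) / (\<i> * complex_of_real x))"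
      by (intro continuous_intros) auto
    hence "continuous_on (- {0}) Xi"
      by (rule continuous_on_eq) (simp add: Xi_def)
    thus ?thesis
      using False by (simp add: continuous_on_eq_continuous_at open_Compl)
  qed
  thus ?thesis
    by (simp add: continuous_on_eq_continuous_at)
qed

lemma Xi_has_vector_derivative:
  assumes "\<xi> \<noteq> 0"
  shows "(Xi has_vector_derivative (exp (- (\<i> * complex_of_real \<xi>)) - Xi \<xi>) / complex_of_real \<xi>) (at \<xi>)"
proof (rule has_vector_derivative_transform_within_open)
  let ?F = "\<lambda>z. (1 - exp (- (\<i> * z))) / (\<i> * z)"
  have "(?F has_field_derivative (exp (- (\<i> * complex_of_real \<xi>)) - Xi \<xi>) / complex_of_real \<xi>)
          (at (complex_of_real \<xi>))"
    using assms by (auto intro!: derivative_eq_intros simp: Xi_def field_simps)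
  thus "((\<lambda>x. ?F (complex_of_real x)) has_vector_derivative
          (exp (- (\<i> * complex_of_real \<xi>)) - Xi \<xi>) / complex_of_real \<xi>) (at \<xi>)"
    by (rule has_vector_derivative_real_field)
  show "open (- {0::real})" by (simp add: open_Compl)
qed (use assms in \<open>auto simp: Xi_def\<close>)

text \<open>The first bound gives decay on distant periods. The second, found by inserting 1 between
  the two terms of the numerator, stays finite near 0.\<close>

lemma norm_Xi_deriv_le:
  assumes "\<xi> \<noteq> 0"
  shows "norm ((exp (- (\<i> * complex_of_real \<xi>)) - Xi \<xi>) / complex_of_real \<xi>) \<le> 2 / \<bar>\<xi>\<bar>"
    and "norm ((exp (- (\<i> * complex_of_real \<xi>)) - Xi \<xi>) / complex_of_real \<xi>) \<le> 2"
proof -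
  have "norm (exp (- (\<i> * complex_of_real \<xi>)) - Xi \<xi>) \<le> 2"
    by (rule norm_triangle_le_diff) (use norm_Xi_le_1[of \<xi>] in simp)
  thus "norm ((exp (- (\<i> * complex_of_real \<xi>)) - Xi \<xi>) / complex_of_real \<xi>) \<le> 2 / \<bar>\<xi>\<bar>"
    by (simp add: norm_divide divide_right_mono)
  have "norm (exp (- (\<i> * complex_of_real \<xi>)) - 1) \<le> \<bar>\<xi>\<bar>"
    using iexp_approx1[of "-\<xi>" 0] by simp
  moreover have "norm (1 - Xi \<xi>) \<le> \<bar>\<xi>\<bar> / 2"
    using norm_Xi_minus_1_le[of \<xi>] by (simp add: norm_minus_commute)
  ultimately have "norm ((exp (- (\<i> * complex_of_real \<xi>)) - 1) + (1 - Xi \<xi>)) \<le> \<bar>\<xi>\<bar> + \<bar>\<xi>\<bar> / 2"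
    by (rule norm_triangle_mono)
  hence "norm (exp (- (\<i> * complex_of_real \<xi>)) - Xi \<xi>) \<le> 2 * \<bar>\<xi>\<bar>"
    by simp
  thus "norm ((exp (- (\<i> * complex_of_real \<xi>)) - Xi \<xi>) / complex_of_real \<xi>) \<le> 2"
    using assms by (simp add: norm_divide divide_simps)
qed

text \<open>\<open>Ln 0\<close> is unspecified; the value 0 at the zeros of \<open>Xi\<close> makes the power continuous on the whole
  line and agrees with \<open>qpow\<close> everywhere, and with the integrand of \<open>cBspline\<close> off a null set.\<close>
definition Xi_pow :: "complex \<Rightarrow> real \<Rightarrow> complex" where
  "Xi_pow w \<xi> = (if Xi \<xi> = 0 then 0 else exp (w * Ln (Xi \<xi>)))"

text \<open>The modulus of exp (w Ln \<zeta>) is |\<zeta>|^(Re w) exp (- Im w arg \<zeta>), and the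
  principal argument is at most pi in absolute value.\<close>

lemma norm_Xi_pow_le: "norm (Xi_pow w \<xi>) \<le> exp (pi * \<bar>Im w\<bar>) * norm (Xi \<xi>) powr Re w"
proof (cases "Xi \<xi> = 0")
  case False
  have "\<bar>Im (Ln (Xi \<xi>))\<bar> \<le> pi"
    using mpi_less_Im_Ln[OF False] Im_Ln_le_pi[OF False] by simp
  hence "\<bar>Im w * Im (Ln (Xi \<xi>))\<bar> \<le> \<bar>Im w\<bar> * pi"
    by (simp add: abs_mult mult_left_mono)
  hence "Re (w * Ln (Xi \<xi>)) \<le> pi * \<bar>Im w\<bar> + Re w * ln (norm (Xi \<xi>))"
    using False by (simp add: mult.commute)
  hence "exp (Re (w * Ln (Xi \<xi>))) \<le> exp (pi * \<bar>Im w\<bar> + Re w * ln (norm (Xi \<xi>)))"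
    by simp
  thus ?thesis
    using False by (simp add: Xi_pow_def powr_def exp_add)
qed (simp add: Xi_pow_def)

lemma Xi_pow_minus: "Xi_pow w (-\<xi>) = cnj (Xi_pow (cnj w) \<xi>)"
proof (cases "Xi \<xi> = 0")
  case False
  hence "cnj (Ln (Xi \<xi>)) = Ln (cnj (Xi \<xi>))"
    using Xi_nonpos_Reals_imp_0[of \<xi>] by (intro cnj_Ln) auto
  thus ?thesis
    by (simp add: Xi_pow_def Xi_minus exp_cnj)
qed (simp add: Xi_pow_def Xi_minus)

text \<open>At a zero of \<open>Xi\<close> the bound \<open>norm_Xi_pow_le\<close> forces the limit
  0, as Re w > 0; elsewhere \<open>Xi\<close> stays off the branch cut.\<close>

lemma continuous_Xi_pow:
  assumes "Re w > 0"
  shows "continuous_on UNIV (Xi_pow w)"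
proof -
  have "isCont (Xi_pow w) \<xi>" for \<xi>
  proof (cases "Xi \<xi> = 0")
    case True
    have lim: "Xi \<midarrow>\<xi>\<rightarrow> 0"
      using continuous_Xi True by (metis continuous_on_eq_continuous_at isCont_def open_UNIV UNIV_I)
    have "Xi_pow w \<midarrow>\<xi>\<rightarrow> 0"
    proof (rule Lim_null_comparison)
      show "\<forall>\<^sub>F x in at \<xi>. norm (Xi_pow w x) \<le> exp (pi * \<bar>Im w\<bar>) * norm (Xi x) powr Re w"
        by (simp add: norm_Xi_pow_le)
      have "((\<lambda>x. norm (Xi x) powr Re w) \<longlongrightarrow> 0) (at \<xi>)"
        by (rule tendsto_zero_powrI[where b = "Re w"])
           (use lim assms in \<open>auto intro: tendsto_norm_zero\<close>)
      thus "((\<lambda>x. exp (pi * \<bar>Im w\<bar>) * norm (Xi x) powr Re w) \<longlongrightarrow> 0) (at \<xi>)"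
        by (rule tendsto_mult_right_zero)
    qed
    thus ?thesis
      using True by (simp add: isCont_def Xi_pow_def)
  next
    case False
    let ?U = "{x. Xi x \<noteq> 0}"
    have "open ?U"
      by (rule open_Collect_neq) (auto intro: continuous_Xi)
    moreover have "continuous_on ?U (Xi_pow w)"
    proof (rule continuous_on_eq)
      show "continuous_on ?U (\<lambda>x. exp (w * Ln (Xi x)))"
        using Xi_nonpos_Reals_imp_0
        by (intro continuous_intros continuous_on_subset[OF continuous_Xi]) auto
    qed (auto simp: Xi_pow_def)
    ultimately show ?thesis
      using False by (simp add: continuous_on_eq_continuous_at)
  qed
  thus ?thesis
    by (simp add: continuous_on_eq_continuous_at)
qed

lemma Xi_pow_has_vector_derivative:
  assumes "\<xi> \<noteq> 0" "Xi \<xi> \<noteq> 0"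
  shows "(Xi_pow w has_vector_derivative
           w * Xi_pow (w - 1) \<xi> * ((exp (- (\<i> * complex_of_real \<xi>)) - Xi \<xi>) / complex_of_real \<xi>)) (at \<xi>)"
    (is "(_ has_vector_derivative ?D) _")
proof (rule has_vector_derivative_transform_within_open)
  have "((\<lambda>z. exp (w * Ln z)) has_field_derivative w * Xi_pow (w - 1) \<xi>) (at (Xi \<xi>))"
    using assms Xi_nonpos_Reals_imp_0[of \<xi>]
    by (auto intro!: derivative_eq_intros simp: Xi_pow_def left_diff_distrib exp_diff field_simps)
  from field_vector_diff_chain_at[OF Xi_has_vector_derivative[OF assms(1)] this]
  show "((\<lambda>x. exp (w * Ln (Xi x))) has_vector_derivative ?D) (at \<xi>)"
    by (simp add: o_def mult_ac)
  show "open {x. Xi x \<noteq> 0}"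
    by (rule open_Collect_neq) (auto intro: continuous_Xi)
qed (use assms in \<open>auto simp: Xi_pow_def\<close>)

text \<open>Since Re w - 1 > 0, the factor \<open>Xi_pow (w - 1)\<close> inherits upper bounds from
  |Xi|. For the decay it contributes the power Re w - 1 of 2 / |\<xi>|, and the derivative of
  \<open>Xi\<close> supplies one more.\<close>

lemma norm_Xi_pow_deriv_le:
  assumes "\<xi> \<noteq> 0" "Xi \<xi> \<noteq> 0" "Re w > 1"
  defines "D \<equiv> w * Xi_pow (w - 1) \<xi> * ((exp (- (\<i> * complex_of_real \<xi>)) - Xi \<xi>) / complex_of_real \<xi>)"
  shows "norm D \<le> 2 * norm w * exp (pi * \<bar>Im w\<bar>)"
    and "norm D \<le> norm w * exp (pi * \<bar>Im w\<bar>) * (2 / \<bar>\<xi>\<bar>) powr Re w"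
proof -
  let ?X = "(exp (- (\<i> * complex_of_real \<xi>)) - Xi \<xi>) / complex_of_real \<xi>"
  have X: "norm ?X \<le> 2" "norm ?X \<le> 2 / \<bar>\<xi>\<bar>"
    using norm_Xi_deriv_le[OF assms(1)] by blast+
  have D: "norm D = norm w * norm (Xi_pow (w - 1) \<xi>) * norm ?X"
    by (simp only: D_def norm_mult)
  have P: "norm (Xi_pow (w - 1) \<xi>) \<le> exp (pi * \<bar>Im w\<bar>) * norm (Xi \<xi>) powr (Re w - 1)"
    using norm_Xi_pow_le[of "w - 1" \<xi>] by simp
  have "norm (Xi \<xi>) powr (Re w - 1) \<le> 1"
    using assms(3) norm_Xi_le_1[of \<xi>] by (intro powr_le1) auto
  hence "norm (Xi_pow (w - 1) \<xi>) \<le> exp (pi * \<bar>Im w\<bar>)"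
    using P by (smt (verit) exp_gt_zero mult_left_le)
  hence "norm w * norm (Xi_pow (w - 1) \<xi>) * norm ?X \<le> norm w * exp (pi * \<bar>Im w\<bar>) * 2"
    by (intro mult_mono X) auto
  thus "norm D \<le> 2 * norm w * exp (pi * \<bar>Im w\<bar>)"
    by (simp add: D mult_ac)
  have "norm (Xi \<xi>) \<le> 2 / \<bar>\<xi>\<bar>"
    using abs_mult_norm_Xi_le[of \<xi>] assms(1) by (simp add: field_simps)
  hence "norm (Xi \<xi>) powr (Re w - 1) \<le> (2 / \<bar>\<xi>\<bar>) powr (Re w - 1)"
    using assms(3) by (intro powr_mono2) auto
  hence "norm (Xi_pow (w - 1) \<xi>) \<le> exp (pi * \<bar>Im w\<bar>) * (2 / \<bar>\<xi>\<bar>) powr (Re w - 1)"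
    using P by (smt (verit) exp_gt_zero mult_left_mono)
  hence "norm w * norm (Xi_pow (w - 1) \<xi>) * norm ?X
           \<le> norm w * (exp (pi * \<bar>Im w\<bar>) * (2 / \<bar>\<xi>\<bar>) powr (Re w - 1)) * (2 / \<bar>\<xi>\<bar>)"
    by (intro mult_mono X) auto
  also have "\<dots> = norm w * exp (pi * \<bar>Im w\<bar>) * (2 / \<bar>\<xi>\<bar>) powr Re w"
    using assms(1) powr_add[of "2 / \<bar>\<xi>\<bar>" "Re w - 1" 1] by simp
  finally show "norm D \<le> norm w * exp (pi * \<bar>Im w\<bar>) * (2 / \<bar>\<xi>\<bar>) powr Re w"
    by (simp add: D)
qed

subsection \<open>Trigonometric polynomials and integration by parts\<close>

text \<open>Integration by parts moves the derivative from H onto f, without boundary terms because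
  f vanishes at both ends. The elementary bound |H| \<le> (1 + |H|^2) / 2 then replaces the L1 norm
  of H by an L2 norm, which orthogonality evaluates exactly. \<open>S\<close> collects points where
  f may fail to be differentiable.\<close>

lemma norm_integral_mult_derivative_le:
  fixes f f' h H :: "real \<Rightarrow> complex"
  assumes "finite S" and "\<alpha> \<le> \<beta>" and f: "continuous_on {\<alpha>..\<beta>} f" "f \<alpha> = 0" "f \<beta> = 0"
    and f': "\<And>x. x \<in> {\<alpha><..<\<beta>} - S \<Longrightarrow> (f has_vector_derivative f' x) (at x)"
    and M: "\<And>x. x \<in> {\<alpha><..<\<beta>} - S \<Longrightarrow> norm (f' x) \<le> M" and "M \<ge> 0"
    and H: "\<And>x. (H has_vector_derivative h x) (at x)" and h: "continuous_on UNIV h"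
  shows "norm (integral {\<alpha>..\<beta>} (\<lambda>x. f x * h x)) \<le>
           M * integral {\<alpha>..\<beta>} (\<lambda>x. (1 + (norm (H x))\<^sup>2) / 2)"
proof -
  let ?I = "integral {\<alpha>..\<beta>} (\<lambda>x. f x * h x)"
  \<comment> \<open>Nothing is known about f' on \<open>S\<close> and at the endpoints; the value 0
    there leaves the integral unchanged and makes the pointwise bound hold everywhere.\<close>
  let ?g = "\<lambda>x. if x \<in> S \<union> {\<alpha>, \<beta>} then 0 else f' x * H x"
  have contH: "continuous_on A H" for A
    using H by (auto intro!: continuous_at_imp_continuous_on has_vector_derivative_continuous)
  have "((\<lambda>x. f x * h x) has_integral ?I) {\<alpha>..\<beta>}"
    by (intro integrable_integral integrable_continuous_real continuous_intros f
          continuous_on_subset[OF h]) auto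
  hence "((\<lambda>x. f' x * H x) has_integral - ?I) {\<alpha>..\<beta>}"
    using f' H f(2,3)
    by (intro integration_by_parts_interior_strong[OF bounded_bilinear_mult assms(1,2) f(1) contH,
            where g' = h]) simp_all
  hence g: "(?g has_integral - ?I) {\<alpha>..\<beta>}"
    by (rule has_integral_spike_finite[rotated 2, where S = "S \<union> {\<alpha>, \<beta>}"])
       (use assms(1) in auto)
  have "norm (integral {\<alpha>..\<beta>} ?g) \<le> integral {\<alpha>..\<beta>} (\<lambda>x. M * ((1 + (norm (H x))\<^sup>2) / 2))"
  proof (rule integral_norm_bound_integral)
    show "?g integrable_on {\<alpha>..\<beta>}"
      using g by blast
    show "(\<lambda>x. M * ((1 + (norm (H x))\<^sup>2) / 2)) integrable_on {\<alpha>..\<beta>}"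
      by (intro integrable_continuous_real continuous_intros contH) auto
    fix x assume x: "x \<in> {\<alpha>..\<beta>}"
    have "norm (H x) \<le> (1 + (norm (H x))\<^sup>2) / 2"
      using zero_le_power2[of "norm (H x) - 1"] by (simp add: power2_diff)
    hence "norm (f' x * H x) \<le> M * ((1 + (norm (H x))\<^sup>2) / 2)" if "x \<in> {\<alpha><..<\<beta>} - S"
      unfolding norm_mult by (intro mult_mono M that) (use \<open>M \<ge> 0\<close> in auto)
    thus "norm (?g x) \<le> M * ((1 + (norm (H x))\<^sup>2) / 2)"
      using x \<open>M \<ge> 0\<close> by auto
  qed
  also have "integral {\<alpha>..\<beta>} ?g = - ?I"
    using g by (rule integral_unique)
  finally show ?thesis
    by simp
qed

lemma has_integral_iexp_periods:
  fixes l m n :: int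
  assumes "m \<le> n"
  shows "((\<lambda>x. exp (\<i> * of_int l * complex_of_real x)) has_integral
           (if l = 0 then 2 * pi * (n - m) else 0)) {2 * pi * m..2 * pi * n}"
proof (cases "l = 0")
  case True
  thus ?thesis
    using has_integral_const_real[of "1::complex" "2 * pi * m" "2 * pi * n"] assms
    by (simp add: scaleR_conv_of_real right_diff_distrib)
next
  case False
  let ?F = "\<lambda>x. exp (\<i> * of_int l * complex_of_real x) / (\<i> * of_int l)"
  have "((\<lambda>x. exp (\<i> * of_int l * complex_of_real x)) has_integral
          ?F (2 * pi * n) - ?F (2 * pi * m)) {2 * pi * m..2 * pi * n}"
  proof (rule fundamental_theorem_of_calculus)
    fix x
    have "((\<lambda>z. exp (\<i> * of_int l * z) / (\<i> * of_int l)) has_field_derivative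
            exp (\<i> * of_int l * complex_of_real x)) (at (complex_of_real x))"
      using False by (auto intro!: derivative_eq_intros)
    thus "(?F has_vector_derivative exp (\<i> * of_int l * complex_of_real x))
            (at x within {2 * pi * m..2 * pi * n})"
      by (rule has_vector_derivative_at_within[OF has_vector_derivative_real_field])
  qed (use assms in auto)
  moreover have "exp (\<i> * of_int l * complex_of_real (2 * pi * k)) = 1" for k :: int
    unfolding exp_eq_1 by (auto intro!: exI[of _ "l * k"])
  ultimately show ?thesis
    using False by simp
qed

text \<open>Parseval over n - m full periods: after expanding the square into a double sum, only the
  diagonal terms have a nonzero integral.\<close>

lemma has_integral_norm_square_trig_poly:
  fixes c :: "int \<Rightarrow> complex" and m n :: int
  assumes "finite F" and "m \<le> n"
  defines "H \<equiv> (\<lambda>x. \<Sum>l\<in>F. c l * exp (\<i> * of_int l * complex_of_real x))"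
  shows "((\<lambda>x. (norm (H x))\<^sup>2) has_integral 2 * pi * (n - m) * (\<Sum>l\<in>F. (norm (c l))\<^sup>2))
           {2 * pi * m..2 * pi * n}"
proof -
  have eq: "complex_of_real ((norm (H x))\<^sup>2) =
          (\<Sum>l\<in>F. \<Sum>k\<in>F. c l * cnj (c k) * exp (\<i> * of_int (l - k) * complex_of_real x))" for x
    unfolding complex_norm_square H_def cnj_sum sum_product
    by (intro sum.cong refl) (simp add: exp_cnj left_diff_distrib right_diff_distrib exp_diff exp_minus field_simps)
  have "((\<lambda>x. complex_of_real ((norm (H x))\<^sup>2)) has_integral
          (\<Sum>l\<in>F. \<Sum>k\<in>F. c l * cnj (c k) * (if l - k = 0 then 2 * pi * (n - m) else 0)))
           {2 * pi * m..2 * pi * n}"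
    unfolding eq
    by (intro has_integral_sum has_integral_mult_right has_integral_iexp_periods assms)
  also have "(\<Sum>l\<in>F. \<Sum>k\<in>F. c l * cnj (c k) * (if l - k = 0 then 2 * pi * (n - m) else 0)) =
             (\<Sum>l\<in>F. \<Sum>k\<in>F. if l = k then c l * cnj (c k) * (2 * pi * (n - m)) else 0)"
    by (intro sum.cong refl) auto
  also have "\<dots> = (\<Sum>l\<in>F. c l * cnj (c l) * (2 * pi * (n - m)))"
    using assms(1) by (intro sum.cong refl) (simp add: sum.delta)
  also have "\<dots> = complex_of_real (2 * pi * (n - m) * (\<Sum>l\<in>F. (norm (c l))\<^sup>2))"
    unfolding of_real_mult of_real_sum complex_norm_square sum_distrib_right[symmetric]
    by (simp only: mult_ac)
  finally have "((\<lambda>x. complex_of_real ((norm (H x))\<^sup>2)) has_integral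
       complex_of_real (2 * pi * (n - m) * (\<Sum>l\<in>F. (norm (c l))\<^sup>2))) {2 * pi * m..2 * pi * n}" .
  from has_integral_linear[OF this bounded_linear_Re] show ?thesis
    by (simp only: o_def Re_complex_of_real)
qed

lemma summable_inverse_squares: "summable (\<lambda>n. 1 / (real n)\<^sup>2)"
  using inverse_power_summable[of 2, where 'a = real] by (simp add: field_simps)

text \<open>Makes the L2 norm of the trigonometric polynomial bounded independently of F. A
  symmetric interval containing F gives twice a sum over naturals; the terms at 0 vanish because 1 /
  0 = 0.\<close>

lemma sum_inverse_square_le:
  fixes F :: "int set"
  assumes "finite F"
  shows "(\<Sum>l\<in>F. 1 / (real_of_int l)\<^sup>2) \<le> 2 * (\<Sum>n. 1 / (real n)\<^sup>2)"
proof -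
  \<comment> \<open>For empty F the maximum is unspecified, but the inclusion is then
    trivial.\<close>
  define N where "N = Suc (nat (Max (abs ` F)))"
  have "F \<subseteq> {-int N..int N}"
  proof
    fix l assume "l \<in> F"
    hence "\<bar>l\<bar> \<le> Max (abs ` F)"
      using assms by (intro Max_ge) auto
    thus "l \<in> {-int N..int N}" by (auto simp: N_def)
  qed
  hence "(\<Sum>l\<in>F. 1 / (real_of_int l)\<^sup>2) \<le> (\<Sum>l\<in>{-int N..int N}. 1 / (real_of_int l)\<^sup>2)"
    by (intro sum_mono2) auto
  also have "(\<Sum>l\<in>{-int N..int N}. 1 / (real_of_int l)\<^sup>2) = 2 * (\<Sum>n<Suc N. 1 / (real n)\<^sup>2)" for N
  proof (induction N)
    case (Suc N)
    have "{-int (Suc N)..int (Suc N)} = insert (- int (Suc N)) (insert (int (Suc N)) {-int N..int N})"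
      by auto
    hence "(\<Sum>l\<in>{-int (Suc N)..int (Suc N)}. 1 / (real_of_int l)\<^sup>2) =
           2 / (real (Suc N))\<^sup>2 + (\<Sum>l\<in>{-int N..int N}. 1 / (real_of_int l)\<^sup>2)"
      by (simp add: power2_eq_square algebra_simps)
    thus ?case
      unfolding Suc.IH by simp
  qed auto
  also have "2 * (\<Sum>n<Suc N. 1 / (real n)\<^sup>2) \<le> 2 * (\<Sum>n. 1 / (real n)\<^sup>2)"
    using sum_le_suminf[OF summable_inverse_squares, of "{..<Suc N}"] by simp
  finally show ?thesis .
qed

subsection \<open>Absolute convergence of the B-spline series\<close>

text \<open>Up to a constant this is the majorant of \<open>Xi_pow\<close>: the exponent
  \<open>max 1 \<bar>x\<bar>\<close> merges the bounds |Xi| \<le> 1 and |Xi| \<le> 2 / |x|, with a =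
  Re w.\<close>

lemma integrable_max_powr:
  assumes "a > 1"
  shows "integrable lborel (\<lambda>x::real. max 1 \<bar>x\<bar> powr (-a))"
proof -
  let ?h = "\<lambda>x::real. indicator {1..} x *\<^sub>R (x powr (-a))"
  have "(\<lambda>x::real. x powr (-a)) absolutely_integrable_on {1..}"
    using has_integral_powr_to_inf[of "-a" 1] assms
    by (intro nonnegative_absolutely_integrable_1) auto
  hence h: "integrable lborel ?h"
    unfolding set_integrable_def by (subst (asm) integrable_completion) auto
  \<comment> \<open>The left tail is the reflection of the right one; on {-1..1} the function is
    1.\<close>
  have "integrable lborel (\<lambda>x. ?h (0 + (-1) * x))"
    by (rule lborel_integrable_real_affine[OF h]) simp
  hence "integrable lborel (\<lambda>x. indicator {-1..1} x + ?h x + ?h (0 + (-1) * x))"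
    using h by (intro Bochner_Integration.integrable_add) auto
  thus ?thesis
    by (rule Bochner_Integration.integrable_bound)
       (auto simp: indicator_def max_def)
qed

lemma integrable_Xi_pow:
  assumes "Re w > 1"
  shows "integrable lborel (Xi_pow w)"
proof (rule Bochner_Integration.integrable_bound)
  let ?g = "\<lambda>x::real. (exp (pi * \<bar>Im w\<bar>) * 2 powr Re w) * max 1 \<bar>x\<bar> powr (-Re w)"
  show "integrable lborel ?g"
    using integrable_max_powr[OF assms] by (rule integrable_mult_right)
  show "Xi_pow w \<in> borel_measurable lborel"
    using continuous_Xi_pow[of w] assms by (simp add: borel_measurable_continuous_onI)
  have "norm (Xi_pow w x) \<le> ?g x" for x
  proof -
    have "norm (Xi x) \<le> 2 / max 1 \<bar>x\<bar>"
      using norm_Xi_le_1[of x] abs_mult_norm_Xi_le[of x] by (auto simp: max_def field_simps)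
    hence "norm (Xi x) powr Re w \<le> (2 / max 1 \<bar>x\<bar>) powr Re w"
      using assms by (intro powr_mono2) auto
    also have "\<dots> = 2 powr Re w * max 1 \<bar>x\<bar> powr (-Re w)"
      by (simp add: powr_divide powr_minus_divide)
    finally have "exp (pi * \<bar>Im w\<bar>) * norm (Xi x) powr Re w \<le> ?g x"
      by simp
    thus ?thesis
      using norm_Xi_pow_le[of w x] by (rule order_trans[rotated])
  qed
  thus "AE x in lborel. norm (Xi_pow w x) \<le> norm (?g x)"
    by (simp add: abs_mult)
qed

lemma integrable_Xi_pow_iexp:
  assumes "Re w > 1"
  shows "integrable lborel (\<lambda>\<xi>. Xi_pow w \<xi> * exp (\<i> * complex_of_real \<xi> * complex_of_real t))"
proof (rule Bochner_Integration.integrable_bound[OF integrable_Xi_pow[OF assms]])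
  show "(\<lambda>\<xi>. Xi_pow w \<xi> * exp (\<i> * complex_of_real \<xi> * complex_of_real t)) \<in> borel_measurable lborel"
    using continuous_Xi_pow[of w] assms
    by (auto intro!: borel_measurable_continuous_onI continuous_intros)
qed (simp add: norm_mult)

lemma cBspline_eq:
  assumes "Re w > 1"
  shows "cBspline w t = complex_of_real (1 / (2 * pi)) *
           (LINT \<xi>|lborel. Xi_pow w \<xi> * exp (\<i> * complex_of_real \<xi> * complex_of_real t))"
proof -
  have [measurable]: "Xi \<in> borel_measurable borel" "Xi_pow w \<in> borel_measurable borel"
    using continuous_Xi continuous_Xi_pow[of w] assms by (auto intro: borel_measurable_continuous_onI)
  \<comment> \<open>Splitting off the values at the zeros of \<open>Xi\<close> shows that the
    original integrand is measurable, since \<open>Xi\<close> and \<open>Xi_pow\<close> are, and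
    that the two integrands agree almost everywhere.\<close>
  have *: "exp (w * Ln (Xi \<xi>)) = Xi_pow w \<xi> + (if Xi \<xi> = 0 then exp (w * Ln 0) else 0)" for \<xi>
    by (simp add: Xi_pow_def)
  have "{\<xi>. Xi \<xi> = 0} \<in> null_sets lborel"
    by (intro countable_imp_null_set_lborel countable_Xi_zeros)
  hence AE: "AE \<xi> in lborel. Xi \<xi> \<noteq> 0"
    by (drule_tac AE_not_in) simp
  have "(LINT \<xi>|lborel. exp (w * Ln (Xi \<xi>)) * exp (\<i> * complex_of_real \<xi> * complex_of_real t)) =
        (LINT \<xi>|lborel. Xi_pow w \<xi> * exp (\<i> * complex_of_real \<xi> * complex_of_real t))"
  proof (rule integral_cong_AE)
    show "(\<lambda>\<xi>. exp (w * Ln (Xi \<xi>)) * exp (\<i> * complex_of_real \<xi> * complex_of_real t))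
            \<in> borel_measurable lborel"
      unfolding * by measurable
  qed (use AE in \<open>auto simp: *\<close>)
  thus ?thesis
    by (simp add: cBspline_def)
qed

text \<open>The substitution of -\<xi> for \<xi> turns the integrand for \<open>cnj w\<close> into
  the conjugate of the integrand for w.\<close>

lemma cBspline_cnj:
  assumes "Re w > 1"
  shows "cBspline (cnj w) t = cnj (cBspline w t)"
proof -
  have "(LINT \<xi>|lborel. Xi_pow (cnj w) \<xi> * exp (\<i> * complex_of_real \<xi> * complex_of_real t)) =
        (LINT \<xi>|lborel. Xi_pow (cnj w) (-\<xi>) * exp (\<i> * complex_of_real (-\<xi>) * complex_of_real t))"
    using lborel_integral_real_affine[of "-1"
        "\<lambda>\<xi>. Xi_pow (cnj w) \<xi> * exp (\<i> * complex_of_real \<xi> * complex_of_real t)" 0]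
    by simp
  also have "\<dots> = (LINT \<xi>|lborel. cnj (Xi_pow w \<xi> * exp (\<i> * complex_of_real \<xi> * complex_of_real t)))"
    by (simp add: Xi_pow_minus exp_cnj)
  also have "\<dots> = cnj (LINT \<xi>|lborel. Xi_pow w \<xi> * exp (\<i> * complex_of_real \<xi> * complex_of_real t))"
    by (rule Bochner_Integration.integral_cnj)
  finally show ?thesis
    using assms by (simp add: cBspline_eq)
qed

text \<open>The endpoints must be zeros of \<open>Xi\<close> for the boundary terms to vanish; this
  excludes m = 0 and n = 0, because Xi 0 = 1. The point 0 may still lie inside the interval, so it
  joins the exceptional set: the derivative formula divides by \<xi>.\<close>

lemma norm_integral_Xi_pow_periods_le:
  fixes c :: "int \<Rightarrow> complex" and m n :: int
  assumes w: "Re w > 1" and "finite F" and "m \<le> n" "m \<noteq> 0" "n \<noteq> 0" and "M \<ge> 0"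
    and M: "\<And>x. x \<in> {2 * pi * m<..<2 * pi * n} \<Longrightarrow> x \<noteq> 0 \<Longrightarrow> Xi x \<noteq> 0 \<Longrightarrow>
              norm (w * Xi_pow (w - 1) x * ((exp (- (\<i> * complex_of_real x)) - Xi x) / complex_of_real x)) \<le> M"
  shows "norm (integral {2 * pi * m..2 * pi * n}
           (\<lambda>x. Xi_pow w x * (\<Sum>l\<in>F. c l * (\<i> * of_int l) * exp (\<i> * of_int l * complex_of_real x))))
         \<le> M * (pi * (n - m) * (1 + (\<Sum>l\<in>F. (norm (c l))\<^sup>2)))"
proof -
  let ?I = "{2 * pi * m..2 * pi * n}"
  let ?H = "\<lambda>x. \<Sum>l\<in>F. c l * exp (\<i> * of_int l * complex_of_real x)"
  let ?h = "\<lambda>x. \<Sum>l\<in>F. c l * (\<i> * of_int l) * exp (\<i> * of_int l * complex_of_real x)"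
  define S where "S = insert 0 (?I \<inter> {x. Xi x = 0})"
  have le: "2 * pi * m \<le> 2 * pi * n"
    using assms by simp
  have "?I \<inter> {x. Xi x = 0} \<subseteq> (\<lambda>k. 2 * pi * of_int k) ` {m..n}"
    by (auto elim!: Xi_eq_0_imp)
  hence S: "finite S"
    unfolding S_def by (auto intro: finite_subset)
  have H: "(?H has_vector_derivative ?h x) (at x)" for x
  proof -
    have "((\<lambda>z. \<Sum>l\<in>F. c l * exp (\<i> * of_int l * z)) has_field_derivative ?h x) (at (complex_of_real x))"
      by (auto intro!: derivative_eq_intros sum.cong)
    thus ?thesis by (rule has_vector_derivative_real_field)
  qed
  have "norm (integral ?I (\<lambda>x. Xi_pow w x * ?h x)) \<le> M * integral ?I (\<lambda>x. (1 + (norm (?H x))\<^sup>2) / 2)"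
  proof (rule norm_integral_mult_derivative_le[OF S le _ _ _ _ _ \<open>M \<ge> 0\<close> H])
    show "continuous_on ?I (Xi_pow w)"
      using continuous_Xi_pow[of w] w by (auto intro: continuous_on_subset)
    show "Xi_pow w (2 * pi * m) = 0" "Xi_pow w (2 * pi * n) = 0"
      using assms by (simp_all add: Xi_pow_def Xi_2pi)
    fix x assume x: "x \<in> {2 * pi * m<..<2 * pi * n} - S"
    hence x': "x \<in> {2 * pi * m<..<2 * pi * n}" "x \<noteq> 0" "Xi x \<noteq> 0"
      by (auto simp: S_def)
    show "(Xi_pow w has_vector_derivative w * Xi_pow (w - 1) x *
             ((exp (- (\<i> * complex_of_real x)) - Xi x) / complex_of_real x)) (at x)"
      and "norm (w * Xi_pow (w - 1) x * ((exp (- (\<i> * complex_of_real x)) - Xi x) / complex_of_real x)) \<le> M"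
      by (rule Xi_pow_has_vector_derivative[OF x'(2,3)], rule M[OF x'])
  qed (intro continuous_intros)
  also have "((\<lambda>x. (1 + (norm (?H x))\<^sup>2) / 2) has_integral
          (2 * pi * (n - m) + 2 * pi * (n - m) * (\<Sum>l\<in>F. (norm (c l))\<^sup>2)) / 2) ?I"
    using has_integral_const_real[of "1::real" "2 * pi * m" "2 * pi * n"] le
    by (intro has_integral_divide has_integral_add has_integral_norm_square_trig_poly assms)
       (simp_all add: right_diff_distrib)
  hence "integral ?I (\<lambda>x. (1 + (norm (?H x))\<^sup>2) / 2) =
          pi * (n - m) * (1 + (\<Sum>l\<in>F. (norm (c l))\<^sup>2))"
    by (subst integral_unique) (assumption, simp add: field_simps)
  finally show ?thesis .
qed

text \<open>Induction adds one period on each side. The base case treats both periods around 0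
  together, as 0 is no admissible endpoint, with the uniform derivative bound. The later steps use
  the decaying one. Since \<open>0 powr x\<close> is 0, the sum on the right contributes nothing for
  N = 1.\<close>

lemma norm_integral_Xi_pow_trig_poly_le:
  fixes c :: "int \<Rightarrow> complex" and N :: nat
  assumes w: "Re w > 1" and "finite F" and "N \<ge> 1"
  shows "norm (integral {2 * pi * - real N..2 * pi * real N}
           (\<lambda>x. Xi_pow w x * (\<Sum>l\<in>F. c l * (\<i> * of_int l) * exp (\<i> * of_int l * complex_of_real x))))
         \<le> 4 * pi * norm w * exp (pi * \<bar>Im w\<bar>) * (1 + (\<Sum>l\<in>F. (norm (c l))\<^sup>2)) *
             (1 + (\<Sum>k<N. real k powr - Re w))"
  using \<open>N \<ge> 1\<close>
proof (induction N rule: nat_induct_at_least)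
  let ?f = "\<lambda>x. Xi_pow w x * (\<Sum>l\<in>F. c l * (\<i> * of_int l) * exp (\<i> * of_int l * complex_of_real x))"
  define K where "K = 2 * norm w * exp (pi * \<bar>Im w\<bar>)"
  have K: "K \<ge> 0" by (simp add: K_def)
  define A where "A = pi * (1 + (\<Sum>l\<in>F. (norm (c l))\<^sup>2))"
  have const: "4 * pi * norm w * exp (pi * \<bar>Im w\<bar>) * (1 + (\<Sum>l\<in>F. (norm (c l))\<^sup>2)) = 2 * K * A"
    by (simp add: K_def A_def)
  {
    case base
    have "norm (integral {2 * pi * (-1 :: int)..2 * pi * (1 :: int)} ?f) \<le>
            K * (pi * ((1 :: int) - (-1 :: int)) * (1 + (\<Sum>l\<in>F. (norm (c l))\<^sup>2)))"
      using norm_Xi_pow_deriv_le(1)[where w = w] w K assms(2)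
      by (intro norm_integral_Xi_pow_periods_le) (auto simp: K_def)
    thus ?case
      by (simp add: K_def algebra_simps)
  next
    case (Suc N)
    define P where "P = real N powr - Re w"
    have int: "?f integrable_on {x..y}" for x y
      using w by (intro integrable_continuous_real continuous_intros continuous_on_subset[OF continuous_Xi_pow]) auto
    have M: "norm (w * Xi_pow (w - 1) x * ((exp (- (\<i> * complex_of_real x)) - Xi x) / complex_of_real x)) \<le> K * P"
      if "x \<noteq> 0" "Xi x \<noteq> 0" "\<bar>x\<bar> \<ge> 2 * pi * N" for x
    proof -
      \<comment> \<open>Discarding the factor pi turns 2 / |x| into the simple bound 1 / N.\<close>
      have "2 * real N \<le> 2 * pi * N"
        using pi_gt3 by (intro mult_right_mono) auto
      hence "2 * real N \<le> \<bar>x\<bar>"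
        using that(3) by linarith
      hence "2 / \<bar>x\<bar> \<le> 1 / real N"
        using Suc.hyps that(1) by (simp add: field_simps)
      hence "(2 / \<bar>x\<bar>) powr Re w \<le> (1 / real N) powr Re w"
        using w by (intro powr_mono2) auto
      also have "\<dots> = P"
        by (simp add: P_def powr_divide powr_minus_divide)
      finally have "norm w * exp (pi * \<bar>Im w\<bar>) * (2 / \<bar>x\<bar>) powr Re w \<le> norm w * exp (pi * \<bar>Im w\<bar>) * P"
        by (intro mult_left_mono) auto
      also have "\<dots> \<le> K * P"
        by (intro mult_right_mono) (auto simp: K_def P_def)
      finally show ?thesis
        using norm_Xi_pow_deriv_le(2)[OF that(1,2) w] by linarith
    qed
    have "norm (integral {2 * pi * (int N)..2 * pi * (int N + 1)} ?f) \<le>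
            K * P * (pi * (int N + 1 - int N) * (1 + (\<Sum>l\<in>F. (norm (c l))\<^sup>2)))"
      using M w assms(2) Suc.hyps K
      by (intro norm_integral_Xi_pow_periods_le) (auto simp: P_def)
    hence right: "norm (integral {2 * pi * real N..2 * pi * real (Suc N)} ?f) \<le> K * P * A"
      by (simp add: A_def algebra_simps)
    have "norm (integral {2 * pi * (- (int N + 1))..2 * pi * (- int N)} ?f) \<le>
            K * P * (pi * (- int N - - (int N + 1)) * (1 + (\<Sum>l\<in>F. (norm (c l))\<^sup>2)))"
      using M w assms(2) Suc.hyps K
      by (intro norm_integral_Xi_pow_periods_le) (auto simp: P_def)
    hence left: "norm (integral {2 * pi * - real (Suc N)..2 * pi * - real N} ?f) \<le> K * P * A"
      by (simp add: A_def algebra_simps)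
    have order: "2 * pi * - real (Suc N) \<le> 2 * pi * - real N" "2 * pi * - real N \<le> 2 * pi * real N"
      "2 * pi * real N \<le> 2 * pi * real (Suc N)" "2 * pi * - real N \<le> 2 * pi * real (Suc N)"
      by (intro mult_left_mono; simp)+
    have split: "integral {2 * pi * - real (Suc N)..2 * pi * real (Suc N)} ?f =
            integral {2 * pi * - real (Suc N)..2 * pi * - real N} ?f +
            (integral {2 * pi * - real N..2 * pi * real N} ?f +
             integral {2 * pi * real N..2 * pi * real (Suc N)} ?f)"
      using order by (simp only: Henstock_Kurzweil_Integration.integral_combine[OF _ _ int])
    have "norm (integral {2 * pi * - real (Suc N)..2 * pi * real (Suc N)} ?f) \<le>
            K * P * A + (2 * K * A * (1 + (\<Sum>k<N. real k powr - Re w)) + K * P * A)"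
      unfolding split by (intro norm_triangle_mono left right Suc.IH[unfolded const])
    also have "\<dots> = 2 * K * A * (1 + (\<Sum>k<Suc N. real k powr - Re w))"
      unfolding sum.lessThan_Suc P_def[symmetric] by (simp add: algebra_simps)
    finally show ?case unfolding const .
  }
qed

lemma summable_norm_cBspline:
  assumes "Re w > 1"
  shows "(\<lambda>l::int. norm (cBspline w (of_int l))) summable_on UNIV"
proof -
  define J where "J = (\<lambda>l::int. LINT x|lborel. Xi_pow w x * exp (\<i> * complex_of_real x * complex_of_real (of_int l)))"
  define B where "B = 4 * pi * norm w * exp (pi * \<bar>Im w\<bar>) * (1 + 2 * (\<Sum>n. 1 / (real n)\<^sup>2)) *
                        (1 + (\<Sum>k. real k powr - Re w))"
  have powr_summable: "summable (\<lambda>k. real k powr - Re w)"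
    using assms by (simp add: summable_real_powr_iff)
  have bound: "(\<Sum>l\<in>F. norm (J l)) \<le> B" if F: "finite F" "0 \<notin> F" for F
  proof -
    \<comment> \<open>\<open>u l\<close> rotates \<open>J l\<close> onto the nonnegative axis,
      making the sum of norms linear in J. The \<open>c l\<close> are the coefficients of a
      primitive of \<open>?h\<close>, whence the exclusion of l = 0.\<close>
    define u where "u = (\<lambda>l. cnj (sgn (J l)))"
    define c where "c = (\<lambda>l. u l / (\<i> * of_int l))"
    let ?h = "\<lambda>x. \<Sum>l\<in>F. c l * (\<i> * of_int l) * exp (\<i> * of_int l * complex_of_real x)"
    have uJ: "u l * J l = norm (J l)" for l
      using complex_norm_square[of "J l"]
      by (cases "J l = 0") (simp_all add: u_def sgn_div_norm scaleR_conv_of_real power2_eq_square field_simps)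
    have c: "(\<Sum>l\<in>F. (norm (c l))\<^sup>2) \<le> 2 * (\<Sum>n. 1 / (real n)\<^sup>2)"
    proof -
      have "(norm (c l))\<^sup>2 \<le> 1 / (real_of_int l)\<^sup>2" for l
        by (auto simp: c_def u_def norm_divide norm_mult norm_sgn power_divide)
      hence "(\<Sum>l\<in>F. (norm (c l))\<^sup>2) \<le> (\<Sum>l\<in>F. 1 / (real_of_int l)\<^sup>2)"
        by (rule sum_mono)
      with sum_inverse_square_le[OF F(1)] show ?thesis by simp
    qed
    have h: "Xi_pow w x * ?h x = (\<Sum>l\<in>F. u l * (Xi_pow w x * exp (\<i> * complex_of_real x * complex_of_real (of_int l))))" for x
      unfolding sum_distrib_left using F(2)
      by (intro sum.cong refl) (auto simp: c_def mult_ac)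
    have int: "integrable lborel (\<lambda>x. Xi_pow w x * ?h x)"
      unfolding h by (intro Bochner_Integration.integrable_sum integrable_mult_right integrable_Xi_pow_iexp assms)
    have "(LINT x|lborel. Xi_pow w x * ?h x) = (\<Sum>l\<in>F. u l * J l)"
      unfolding h J_def
      by (subst Bochner_Integration.integral_sum)
         (simp_all only: integral_mult_right_zero integrable_mult_right integrable_Xi_pow_iexp assms)
    hence sum_eq: "(\<Sum>l\<in>F. norm (J l)) = norm (LINT x|lborel. Xi_pow w x * ?h x)"
      by (simp add: uJ sum_nonneg flip: of_real_sum)
    \<comment> \<open>Truncating to whole periods lets the bound for finite intervals pass to the
      integral over the line.\<close>
    have "(\<lambda>N. LINT x|lborel. indicator {2 * pi * - real N..2 * pi * real N} x *\<^sub>R (Xi_pow w x * ?h x))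
            \<longlonglongrightarrow> (LINT x|lborel. Xi_pow w x * ?h x)"
    proof (rule integral_dominated_convergence)
      show "integrable lborel (\<lambda>x. norm (Xi_pow w x * ?h x))"
        using int by (rule integrable_norm)
      show "AE x in lborel. (\<lambda>N. indicator {2 * pi * - real N..2 * pi * real N} x *\<^sub>R (Xi_pow w x * ?h x))
              \<longlonglongrightarrow> Xi_pow w x * ?h x"
      proof (intro AE_I2 tendsto_eventually)
        fix x :: real
        obtain N0 where N0: "\<bar>x\<bar> / (2 * pi) \<le> real N0"
          using real_arch_simple by blast
        show "\<forall>\<^sub>F N in sequentially. indicator {2 * pi * - real N..2 * pi * real N} x *\<^sub>R (Xi_pow w x * ?h x)
                = Xi_pow w x * ?h x"
          using eventually_ge_at_top[of N0]
        proof eventually_elim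
          case (elim N)
          hence "\<bar>x\<bar> / (2 * pi) \<le> real N"
            using N0 by linarith
          hence "\<bar>x\<bar> \<le> 2 * pi * real N"
            by (simp add: field_simps)
          thus ?case by (auto simp: abs_le_iff)
        qed
      qed
    qed (use int in \<open>auto simp: indicator_def intro: borel_measurable_integrable\<close>)
    hence "(\<lambda>N. norm (integral {2 * pi * - real N..2 * pi * real N} (\<lambda>x. Xi_pow w x * ?h x)))
             \<longlonglongrightarrow> norm (LINT x|lborel. Xi_pow w x * ?h x)"
      using set_borel_integral_eq_integral(2)[of _ "\<lambda>x. Xi_pow w x * ?h x"] int
      by (intro tendsto_norm) (simp add: set_lebesgue_integral_def set_integrable_def integrable_mult_indicator)
    moreover have "norm (integral {2 * pi * - real N..2 * pi * real N} (\<lambda>x. Xi_pow w x * ?h x)) \<le> B"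
      if "N \<ge> 1" for N
    proof -
      have "norm (integral {2 * pi * - real N..2 * pi * real N} (\<lambda>x. Xi_pow w x * ?h x))
              \<le> 4 * pi * norm w * exp (pi * \<bar>Im w\<bar>) * (1 + (\<Sum>l\<in>F. (norm (c l))\<^sup>2)) *
                (1 + (\<Sum>k<N. real k powr - Re w))"
        by (rule norm_integral_Xi_pow_trig_poly_le[OF assms F(1) that])
      also have "\<dots> \<le> B"
        unfolding B_def using c sum_le_suminf[OF powr_summable, of "{..<N}"]
        by (intro mult_mono add_mono mult_nonneg_nonneg add_nonneg_nonneg sum_nonneg order.refl)
           (auto intro!: suminf_nonneg summable_inverse_squares)
      finally show ?thesis .
    qed
    ultimately show ?thesis
      unfolding sum_eq by (intro LIMSEQ_le_const2) auto
  qed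
  \<comment> \<open>Bounded finite partial sums of nonnegative terms give summability; the single
    index 0 is restored afterwards.\<close>
  have "(\<lambda>l. norm (J l)) summable_on (UNIV - {0})"
  proof (rule nonneg_bdd_above_summable_on)
    show "bdd_above (sum (\<lambda>l. norm (J l)) ` {F. F \<subseteq> UNIV - {0} \<and> finite F})"
      by (intro bdd_aboveI[of _ B]) (auto intro!: bound)
  qed auto
  hence "(\<lambda>l. norm (J l)) summable_on (insert 0 (UNIV - {0}))"
    by (simp only: summable_on_insert_iff)
  hence "(\<lambda>l. norm (J l)) summable_on UNIV"
    by (simp add: insert_UNIV)
  hence "(\<lambda>l. 1 / (2 * pi) * norm (J l)) summable_on UNIV"
    by (rule summable_on_cmult_right)
  thus ?thesis
    using assms by (simp add: cBspline_eq J_def norm_mult norm_divide)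
qed

subsection \<open>Inverses of complex quaternions\<close>

text \<open>Quaternionic conjugation only: the complex coefficients are not conjugated, so that the
  product with x is a complex scalar.\<close>

definition cq_cnj :: "cquat \<Rightarrow> cquat" where
  "cq_cnj x = CQuat (cq_sc x) (- cq_1 x) (- cq_2 x) (- cq_3 x)"

text \<open>A complex quadratic form rather than a modulus: it can vanish at nonzero x, which is why
  invertibility is a genuine condition.\<close>

definition cq_norm2 :: "cquat \<Rightarrow> complex" where
  "cq_norm2 x = (cq_sc x)\<^sup>2 + (cq_1 x)\<^sup>2 + (cq_2 x)\<^sup>2 + (cq_3 x)\<^sup>2"

lemma cq_mult_assoc: "cq_mult (cq_mult x y) z = cq_mult x (cq_mult y z)"
  by (simp add: cq_mult_def algebra_simps)

lemma cq_mult_one [simp]: "cq_mult cq_one x = x" "cq_mult x cq_one = x"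
  by (simp_all add: cq_mult_def cq_one_def)

lemma cq_mult_cnj:
  "cq_mult x (cq_scale c (cq_cnj x)) = cq_scale (c * cq_norm2 x) cq_one"
  "cq_mult (cq_scale c (cq_cnj x)) x = cq_scale (c * cq_norm2 x) cq_one"
  by (simp_all add: cq_mult_def cq_cnj_def cq_norm2_def cq_one_def cq_scale_def power2_eq_square algebra_simps)

lemma cq_norm2_mult: "cq_norm2 (cq_mult x y) = cq_norm2 x * cq_norm2 y"
  by (simp add: cq_norm2_def cq_mult_def power2_eq_square algebra_simps)

text \<open>Multiplicativity of \<open>cq_norm2\<close> rules out a zero norm for units; conversely
  the conjugate divided by the norm is an inverse.\<close>

lemma cq_invertible_iff: "cq_invertible x \<longleftrightarrow> cq_norm2 x \<noteq> 0"
proof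
  assume "cq_invertible x"
  then obtain y where "cq_mult x y = cq_one"
    by (auto simp: cq_invertible_def)
  hence "cq_norm2 x * cq_norm2 y = cq_norm2 cq_one"
    by (metis cq_norm2_mult)
  thus "cq_norm2 x \<noteq> 0"
    by (auto simp: cq_norm2_def cq_one_def)
next
  assume "cq_norm2 x \<noteq> 0"
  thus "cq_invertible x"
    using cq_mult_cnj[where x = x and c = "inverse (cq_norm2 x)"]
    by (auto simp: cq_invertible_def cq_scale_def cq_one_def)
qed

lemma cq_inverse_eq:
  assumes "cq_norm2 x \<noteq> 0"
  shows "cq_inverse x = cq_scale (inverse (cq_norm2 x)) (cq_cnj x)"
  unfolding cq_inverse_def
proof (rule the_equality)
  let ?y = "cq_scale (inverse (cq_norm2 x)) (cq_cnj x)"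
  show y: "cq_mult x ?y = cq_one \<and> cq_mult ?y x = cq_one"
    unfolding cq_mult_cnj using assms by (simp add: cq_scale_def cq_one_def)
  fix y' assume "cq_mult x y' = cq_one \<and> cq_mult y' x = cq_one"
  thus "y' = ?y"
    using y by (metis cq_mult_assoc cq_mult_one)
qed

subsection \<open>Quaternionic B-splines\<close>

text \<open>Euler's formulas for cos and sin. As \<open>Ln (Xi \<xi>)\<close> is not real in
  general, C and S need not be the real and imaginary parts of \<open>Xi_pow w \<xi>\<close>; both
  exponents have to be kept until after integration.\<close>

lemma qpow_eq_Xi_pow:
  fixes a \<xi> :: real and v :: "real^3"
  assumes "v \<noteq> 0"
  defines "w \<equiv> Complex a (norm v)"
  defines "C \<equiv> (Xi_pow w \<xi> + Xi_pow (cnj w) \<xi>) / 2" and "S \<equiv> (Xi_pow w \<xi> - Xi_pow (cnj w) \<xi>) / (2 * \<i>)"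
  shows "qpow (Xi \<xi>) a v = CQuat C (complex_of_real (v $ 1 / norm v) * S)
           (complex_of_real (v $ 2 / norm v) * S) (complex_of_real (v $ 3 / norm v) * S)"
proof (cases "Xi \<xi> = 0")
  case True
  thus ?thesis by (simp add: qpow_def C_def S_def Xi_pow_def)
next
  case False
  have w: "w = complex_of_real a + \<i> * complex_of_real (norm v)"
    "cnj w = complex_of_real a - \<i> * complex_of_real (norm v)"
    by (simp_all add: w_def complex_eq_iff)
  have "Xi \<xi> powr complex_of_real a * cos (complex_of_real (norm v) * Ln (Xi \<xi>)) = C"
    using False unfolding C_def Xi_pow_def w
    by (simp add: powr_def cos_exp_eq distrib_right distrib_left left_diff_distrib exp_add exp_diff exp_minus
          field_simps)
  moreover have "Xi \<xi> powr complex_of_real a * sin (complex_of_real (norm v) * Ln (Xi \<xi>)) = S"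
    using False unfolding S_def Xi_pow_def w
    by (simp add: powr_def sin_exp_eq distrib_right distrib_left left_diff_distrib exp_add exp_diff exp_minus
          field_simps)
  ultimately show ?thesis
    using False assms(1) by (simp add: qpow_def mult.assoc mult.left_commute)
qed

text \<open>By \<open>cBspline_cnj\<close> the integrals of the two powers are conjugate to each
  other, so their half sum and half difference become real and imaginary parts.\<close>

lemma qBspline_eq:
  fixes a :: real and v :: "real^3"
  assumes "a > 1" and "v \<noteq> 0"
  defines "w \<equiv> Complex a (norm v)"
  shows "qBspline a v t = CQuat (Re (cBspline w t)) (v $ 1 / norm v * Im (cBspline w t))
           (v $ 2 / norm v * Im (cBspline w t)) (v $ 3 / norm v * Im (cBspline w t))"
proof -
  have w: "Re w > 1" "Re (cnj w) > 1"
    using assms by (simp_all add: w_def)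
  let ?E = "\<lambda>\<xi>. exp (\<i> * complex_of_real \<xi> * complex_of_real t)"
  define I where "I = (\<lambda>w. LINT \<xi>|lborel. Xi_pow w \<xi> * ?E \<xi>)"
  have lin: "(LINT \<xi>|lborel. (\<alpha> * Xi_pow w \<xi> + \<beta> * Xi_pow (cnj w) \<xi>) * ?E \<xi>) = \<alpha> * I w + \<beta> * I (cnj w)" for \<alpha> \<beta>
  proof -
    have "(\<alpha> * Xi_pow w \<xi> + \<beta> * Xi_pow (cnj w) \<xi>) * ?E \<xi> =
            \<alpha> * (Xi_pow w \<xi> * ?E \<xi>) + \<beta> * (Xi_pow (cnj w) \<xi> * ?E \<xi>)" for \<xi>
      by (simp add: distrib_right mult.assoc)
    thus ?thesis
      unfolding I_def using w
      by (simp only: Bochner_Integration.integral_add integral_mult_right_zero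
            integrable_mult_right integrable_Xi_pow_iexp)
  qed
  have B: "cBspline w t = I w / (2 * pi)" "cnj (cBspline w t) = I (cnj w) / (2 * pi)"
    unfolding cBspline_cnj[OF w(1), symmetric] using w by (simp_all add: cBspline_eq I_def)
  have "(LINT \<xi>|lborel. (Xi_pow w \<xi> + Xi_pow (cnj w) \<xi>) / 2 * ?E \<xi>) / (2 * pi) =
          (cBspline w t + cnj (cBspline w t)) / 2"
    unfolding B(2) unfolding B(1) using lin[of "1/2" "1/2"] by (simp add: add_divide_distrib)
  also have "\<dots> = Re (cBspline w t)"
    by (simp add: complex_add_cnj)
  finally have Re: "(LINT \<xi>|lborel. (Xi_pow w \<xi> + Xi_pow (cnj w) \<xi>) / 2 * ?E \<xi>) / (2 * pi) = Re (cBspline w t)" .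
  have Im: "(LINT \<xi>|lborel. r * ((Xi_pow w \<xi> - Xi_pow (cnj w) \<xi>) / (2 * \<i>)) * ?E \<xi>) / (2 * pi) =
         r * Im (cBspline w t)" for r :: complex
  proof -
    have *: "r * ((x - y) / (2 * \<i>)) = r / (2 * \<i>) * x + (- r / (2 * \<i>)) * y" for x y
      by (simp add: diff_divide_distrib right_diff_distrib mult_ac)
    have "(LINT \<xi>|lborel. r * ((Xi_pow w \<xi> - Xi_pow (cnj w) \<xi>) / (2 * \<i>)) * ?E \<xi>) / (2 * pi) =
           r * ((cBspline w t - cnj (cBspline w t)) / (2 * \<i>))"
      unfolding * lin B(2) unfolding B(1) by (simp add: field_simps)
    also have "(cBspline w t - cnj (cBspline w t)) / (2 * \<i>) = Im (cBspline w t)"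
      by (simp add: complex_eq_iff)
    finally show ?thesis .
  qed
  have scale: "complex_of_real (1 / (2 * pi)) * x = x / complex_of_real (2 * pi)" for x
    by simp
  show ?thesis
    unfolding qBspline_def Let_def qpow_eq_Xi_pow[OF assms(2)] w_def[symmetric] cquat.sel
      scale Re Im by (simp only: of_real_mult)
qed

theorem theorem2:
  fixes a :: real and v :: "real^3" and z :: complex
  assumes "a > 1" and "v \<noteq> 0" and "norm z = 1"
  defines "w \<equiv> Complex a (norm v)"
  defines "D \<equiv> (\<Sum>\<^sub>\<infinity>l::int. cBspline w (of_int l) * z powi l) *
               (\<Sum>\<^sub>\<infinity>k::int. cBspline (cnj w) (of_int k) * z powi k)"
  defines "N \<equiv> cq_zseries (\<lambda>l. CQuat (complex_of_real (Re (cBspline w (of_int l))))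
                     (- complex_of_real (v $ 1 / norm v * Im (cBspline w (of_int l))))
                     (- complex_of_real (v $ 2 / norm v * Im (cBspline w (of_int l))))
                     (- complex_of_real (v $ 3 / norm v * Im (cBspline w (of_int l))))) z"
  shows "(cq_invertible (cq_zseries (\<lambda>l. qBspline a v (of_int l)) z) \<longleftrightarrow> D \<noteq> 0) \<and>
         (D \<noteq> 0 \<longrightarrow> cq_inverse (cq_zseries (\<lambda>l. qBspline a v (of_int l)) z) = cq_scale (inverse D) N)"
proof -
  define b where "b = (\<lambda>l::int. cBspline w (of_int l))"
  define R where "R = (\<Sum>\<^sub>\<infinity>l. complex_of_real (Re (b l)) * z powi l)"
  define I where "I = (\<Sum>\<^sub>\<infinity>l. complex_of_real (Im (b l)) * z powi l)"
  define n where "n = (\<lambda>j. complex_of_real (v $ j / norm v))"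
  have w: "Re w > 1"
    using assms(1) by (simp add: w_def)
  \<comment> \<open>Applied with g = Re and g = Im; since |z| = 1, the powers of z do not affect the
    norms.\<close>
  have summable: "(\<lambda>l. complex_of_real (g (b l)) * z powi l) summable_on UNIV"
    if "\<And>x. \<bar>g x\<bar> \<le> norm x" for g
  proof (rule abs_summable_summable, rule Infinite_Sum.abs_summable_on_comparison_test)
    show "(\<lambda>l. norm (b l)) summable_on UNIV"
      unfolding b_def by (rule summable_norm_cBspline[OF w])
  qed (use that assms(3) in \<open>auto simp: norm_mult norm_power_int\<close>)
  have sR: "(\<lambda>l. complex_of_real (Re (b l)) * z powi l) summable_on UNIV"
    and sI: "(\<lambda>l. complex_of_real (Im (b l)) * z powi l) summable_on UNIV"
    by (auto intro!: summable abs_Re_le_cmod abs_Im_le_cmod)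
  have "(\<Sum>\<^sub>\<infinity>l. b l * z powi l) =
          (\<Sum>\<^sub>\<infinity>l. complex_of_real (Re (b l)) * z powi l + \<i> * (complex_of_real (Im (b l)) * z powi l))"
    by (rule infsum_cong, subst complex_eq[of "b _"]) (simp add: algebra_simps)
  hence sum_w: "(\<Sum>\<^sub>\<infinity>l. b l * z powi l) = R + \<i> * I"
    unfolding R_def I_def by (simp add: infsum_add sR sI summable_on_cmult_right infsum_cmult_right)
  \<comment> \<open>R and I are complex in general, so this series is not the conjugate of the
    previous one and is computed separately.\<close>
  have "(\<Sum>\<^sub>\<infinity>l. cnj (b l) * z powi l) =
          (\<Sum>\<^sub>\<infinity>l. complex_of_real (Re (b l)) * z powi l + (- \<i>) * (complex_of_real (Im (b l)) * z powi l))"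
    by (rule infsum_cong, subst complex_eq[of "b _"]) (simp add: algebra_simps)
  hence sum_cnj_w: "(\<Sum>\<^sub>\<infinity>l. cnj (b l) * z powi l) = R + (- \<i>) * I"
    unfolding R_def I_def by (simp only: infsum_add sR sI summable_on_cmult_right infsum_cmult_right)
  have D: "D = R\<^sup>2 + I\<^sup>2"
    using sum_w sum_cnj_w unfolding D_def b_def cBspline_cnj[OF w]
    by (simp only:) (simp add: power2_eq_square algebra_simps)
  have b: "cBspline w (of_int l) = b l" for l
    by (simp add: b_def)
  have vec: "(\<Sum>\<^sub>\<infinity>l. complex_of_real (r * Im (b l)) * z powi l) = complex_of_real r * I" for r
    unfolding I_def of_real_mult mult.assoc by (rule infsum_cmult_right[OF sI])
  have vec_minus: "(\<Sum>\<^sub>\<infinity>l. - complex_of_real (r * Im (b l)) * z powi l) = - (complex_of_real r * I)" for r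
    using vec[of r] by (simp add: infsum_uminus)
  have x: "cq_zseries (\<lambda>l. qBspline a v (of_int l)) z = CQuat R (n 1 * I) (n 2 * I) (n 3 * I)"
    unfolding cq_zseries_def qBspline_eq[OF assms(1,2)] w_def[symmetric] b cquat.sel vec R_def n_def ..
  \<comment> \<open>The numerator is the quaternionic conjugate of the series, so the claimed
    inverse is the one from \<open>cq_inverse_eq\<close> once \<open>cq_norm2\<close> of the series
    is identified with D.\<close>
  have N: "N = cq_cnj (CQuat R (n 1 * I) (n 2 * I) (n 3 * I))"
    unfolding N_def cq_zseries_def b cq_cnj_def cquat.sel vec_minus R_def n_def ..
  have "(norm v)\<^sup>2 = (v $ 1)\<^sup>2 + (v $ 2)\<^sup>2 + (v $ 3)\<^sup>2"
    unfolding power2_norm_eq_inner by (simp add: inner_vec_def sum_3 power2_eq_square)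
  hence "(v $ 1 / norm v)\<^sup>2 + (v $ 2 / norm v)\<^sup>2 + (v $ 3 / norm v)\<^sup>2 = 1"
    unfolding power_divide add_divide_distrib[symmetric]
    by (metis assms(2) divide_self norm_eq_zero power_not_zero)
  hence unit: "(n 1)\<^sup>2 + (n 2)\<^sup>2 + (n 3)\<^sup>2 = 1"
    unfolding n_def of_real_power[symmetric] of_real_add[symmetric] by (simp only: of_real_1)
  have "cq_norm2 (CQuat R (n 1 * I) (n 2 * I) (n 3 * I)) = R\<^sup>2 + ((n 1)\<^sup>2 + (n 2)\<^sup>2 + (n 3)\<^sup>2) * I\<^sup>2"
    by (simp add: cq_norm2_def power_mult_distrib algebra_simps)
  hence "cq_norm2 (CQuat R (n 1 * I) (n 2 * I) (n 3 * I)) = D"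
    by (simp add: unit D)
  thus ?thesis
    using cq_invertible_iff cq_inverse_eq unfolding x N by metis
qed

end
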